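(* Let $k$ be a field of characteristic $0$ and let $\lambda\in k$, $\lambda\neq0$. Let $(D,\prec,\succ)$ be a dendriform dialgebra over $k$ with a linear basis $X=\{x_n\mid n\in I\}$, where $I$ is a (nonempty) well-ordered set, and write $x_i\prec x_j=[x_i,x_j]$ and $x_i\succ x_j=[[x_i,x_j]]$, where $[x_i,x_j]$ and $[[x_i,x_j]]$ are linear combinations of elements of $X$, regarded as elements of the free nonunitary Rota-Baxter algebra $RB(X)$ of weight $\lambda$. Let $S\subset RB(X)$ be the set consisting of, for all $i,j,l\in I$, $$x_iP(x_j)+\lambda x_ix_j-[x_i,x_j],$$ $$P(x_i)x_j-[[x_i,x_j]],$$ $$x_ix_jx_l-\lambda^{-1}[x_i,x_j]x_l+\lambda^{-1}x_i[[x_j,x_l]].$$ Then in $RB(X)$ all intersection compositions and all inclusion compositions $(f,g)_w$ of elements $f,g\in S$ are trivial modulo $(S,w)$.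
   Context: Dendriform dialgebra: a $k$-module $D$ with two bilinear operations $\prec,\succ$ such that for all $x,y,z$: $(x\prec y)\prec z=x\prec(y\prec z+y\succ z)$; $(x\succ y)\prec z=x\succ(y\prec z)$; $(x\prec y+x\succ y)\succ z=x\succ(y\succ z)$. Rota-Baxter algebras. A Rota-Baxter algebra of weight $\lambda\in k$ is an associative $k$-algebra $A$ (not assumed unital) with a $k$-linear $P:A\to A$ satisfying $P(x)P(y)=P(P(x)y)+P(xP(y))+\lambda P(xy)$. Free Rota-Baxter algebra $RB(X)$. $S(X)$ is the free semigroup (no identity) on $X$. Put $\Phi_0=S(X)$, and let $\Phi_n$ be the set of all nonempty finite formal words that alternate between factors from $S(X)$ and factors of the form $P(z)$, $z\in\Phi_{n-1}$ (starting and ending with either type; so no two factors $P(z_1)P(z_2)$ are adjacent). $\Phi(X)=\bigcup_{n\ge0}\Phi_n$. An element of $X\cup P(\Phi(X))$ is called prime; every $u\in\Phi(X)$ is uniquely $u=u_1\cdots u_n$ with $u_i$ prime and no two consecutive $u_i$ both in $P(\Phi(X))$. $RB(X)$ is the $k$-vector space with basis $\Phi(X)$, with $P$ the linear extension of $u\mapsto P(u)$ and with bilinear product defined recursively: for primes $u,v$, $u\cdot v=P(P(u')\cdot v')+P(u'\cdot P(v'))+\lambda P(u'\cdot v')$ if $u=P(u')$, $v=P(v')$, and $u\cdot v=uv$ (concatenation) otherwise; for $u=u_1\cdots u_s$, $v=v_1\cdots v_l$ (prime factorizations), $u\cdot v=u_1\cdots u_{s-1}(u_s\cdot v_1)v_2\cdots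 v_l$. Ordering. $X$ is ordered by its index set. For $T\subseteq X\cup\{P\}$, $\deg_T(u)$ is the number of occurrences in $u$ of symbols of $T$; $Deg(u)=(\deg_{\{P\}\cup X}(u),\deg_{\{P\}}(u))$, ordered lexicographically. For $u,v\in\Phi(X)$: if $Deg(u)>Deg(v)$ then $u>v$. If $Deg(u)=Deg(v)$: for $u,v\in X$ use the order of $X$; if $u=P(u')$, $v=P(v')$ then $u>v$ iff $u'>v'$; otherwise, with prime factorizations $u=u_1\cdots u_l$, $v=v_1\cdots v_s$ ($l>1$ or $s>1$), $u>v$ iff $(u_1,\dots,u_l)>(v_1,\dots,v_s)$ lexicographically. This is a well ordering. For $0\ne f\in RB(X)$, $\bar f\in\Phi(X)$ denotes its largest basis word (leading term); $f$ is monic if the coefficient of $\bar f$ is $1$. $s$-words. $\star\notin X$ is a new symbol; $\Phi^\star(X)$ is the set of words in $\Phi(X\cup\{\star\})$ with exactly one occurrence of $\star$. For $u\in\Phi^\star(X)$ and $s\in RB(X)$, $u|_s\in RB(X)$ is the result of replacing $\star$ by $s$ and evaluating in $RB(X)$; it is called an $s$-word. It is a normal $s$-word if $\overline{u|_s}=u|_{\bar s}$. Compositions of monic $f,g$. Intersection composition: if $w=\bar f a=b\bar g$ with $a,b\in\Phi(X)$, $fa$ a normal $f$-word, $bg$ a normal $g$-word, and $\deg_{\{P\}\cup X}(w)<\deg_{\{P\}\cup X}(\bar f)+\deg_{\{P\}\cup X}(\bar g)$, then $(f,g)_w=f\cdot a-b\cdot g$. Inclusion composition: if $w=\bar f=u|_{\bar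 g}$ with $u\in\Phi^\star(X)$, then $(f,g)_w=f-u|_g$. $(f,g)_w$ is trivial modulo $(S,w)$ if $(f,g)_w=\sum_i\alpha_iu_i|_{s_i}$ (finite sum) with $\alpha_i\in k$, $s_i\in S$, $u_i|_{s_i}$ normal $s_i$-words and $u_i|_{\overline{s_i}}<w$. *)

theory Defs
  imports Complex_Main "HOL-Library.Poly_Mapping"
begin

section \<open>Dendriform dialgebras\<close>

locale dendriform_dialgebra = module scale
  for scale :: "'k::comm_ring_1 \<Rightarrow> 'd::ab_group_add \<Rightarrow> 'd"
    and prec :: "'d \<Rightarrow> 'd \<Rightarrow> 'd" (infixl \<open>\<prec>\<close> 70)
    and succ :: "'d \<Rightarrow> 'd \<Rightarrow> 'd" (infixl \<open>\<succ>\<close> 70) +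
  assumes prec_linear_left: "module_hom scale scale (\<lambda>x. x \<prec> y)"
    and prec_linear_right: "module_hom scale scale (\<lambda>y. x \<prec> y)"
    and succ_linear_left: "module_hom scale scale (\<lambda>x. x \<succ> y)"
    and succ_linear_right: "module_hom scale scale (\<lambda>y. x \<succ> y)"
    and prec_prec: "(x \<prec> y) \<prec> z = x \<prec> (y \<prec> z + y \<succ> z)"
    and succ_prec: "(x \<succ> y) \<prec> z = x \<succ> (y \<prec> z)"
    and succ_succ: "(x \<prec> y + x \<succ> y) \<succ> z = x \<succ> (y \<succ> z)"


section \<open>Rota-Baxter words\<close>

text \<open>
  A word is the list of its prime factors. The type \<open>'a\<close> serves as the alphabet \<open>X\<close>.
  The raw type also contains lists that are empty, or have adjacent \<open>P\<close>-factors, possibly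
  inside an argument of \<open>P\<close>; the set \<open>Phi\<close> below singles out \<open>\<Phi>(X)\<close>.
\<close>

datatype 'a letter = Gen 'a | Pw "'a letter list"

type_synonym 'a word = "'a letter list"

primrec Phi_level :: "nat \<Rightarrow> 'a word set" where
  "Phi_level 0 = {u. u \<noteq> [] \<and> set u \<subseteq> range Gen}"
| "Phi_level (Suc n) =
    {u. u \<noteq> [] \<and> set u \<subseteq> range Gen \<union> Pw ` Phi_level n \<and>
        successively (\<lambda>p q. \<not> (p \<in> range Pw \<and> q \<in> range Pw)) u}"

definition Phi :: "'a word set" where
  "Phi = (\<Union>n. Phi_level n)"

primrec letter_gens :: "'a set \<Rightarrow> 'a letter \<Rightarrow> nat" where
  "letter_gens Y (Gen x) = (if x \<in> Y then 1 else 0)"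
| "letter_gens Y (Pw u) = sum_list (map (letter_gens Y) u)"

primrec letter_ops :: "'a letter \<Rightarrow> nat" where
  "letter_ops (Gen x) = 0"
| "letter_ops (Pw u) = 1 + sum_list (map letter_ops u)"

text \<open>Number of occurrences in a word of generators from \<open>Y\<close>, and of the symbol \<open>P\<close>.\<close>

definition deg_gens :: "'a set \<Rightarrow> 'a word \<Rightarrow> nat" where
  "deg_gens Y u = sum_list (map (letter_gens Y) u)"

definition deg_P :: "'a word \<Rightarrow> nat" where
  "deg_P u = sum_list (map letter_ops u)"

definition deg_PX :: "'a word \<Rightarrow> nat" where
  "deg_PX u = deg_gens UNIV u + deg_P u"

definition Deg :: "'a word \<Rightarrow> nat \<times> nat" where
  "Deg u = (deg_PX u, deg_P u)"


section \<open>The ordering of words\<close>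

lemma lexord_pred_mono [mono]:
  assumes "\<And>a b. R a b \<longrightarrow> R' a b"
  shows "(u, v) \<in> lexord {(a, b). R a b} \<longrightarrow> (u, v) \<in> lexord {(a, b). R' a b}"
proof (induction u arbitrary: v)
  case Nil
  show ?case by simp
next
  case (Cons a u)
  with assms show ?case by (cases v) auto
qed

text \<open>
  \<open>word_less u v\<close> means \<open>u < v\<close>. The words occurring in rule \<open>lex\<close> have equal \<open>Deg\<close>, so
  neither is a proper prefix of the other, and the convention of \<^const>\<open>lexord\<close> for
  prefixes plays no role.
\<close>

inductive word_less :: "'a::linorder word \<Rightarrow> 'a word \<Rightarrow> bool" where
  deg: "(Deg u, Deg v) \<in> less_than <*lex*> less_than \<Longrightarrow> word_less u v"
| gen: "x < y \<Longrightarrow> word_less [Gen x] [Gen y]"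
| op: "Deg [Pw u] = Deg [Pw v] \<Longrightarrow> word_less u v \<Longrightarrow> word_less [Pw u] [Pw v]"
| lex: "Deg u = Deg v \<Longrightarrow> length u > 1 \<or> length v > 1 \<Longrightarrow>
    (u, v) \<in> lexord {(p, q). word_less [p] [q]} \<Longrightarrow> word_less u v"


section \<open>The free Rota-Baxter algebra\<close>

text \<open>
  Elements of \<open>RB(X)\<close> are finitely supported functions on words whose support lies in
  \<^const>\<open>Phi\<close>.
\<close>

type_synonym ('a, 'k) rb = "'a word \<Rightarrow>\<^sub>0 'k"

definition RB :: "('a, 'k::field) rb set" where
  "RB = {f. Poly_Mapping.keys f \<subseteq> Phi}"

definition rb_word :: "'a word \<Rightarrow> ('a, 'k::field) rb" where
  "rb_word u = Poly_Mapping.single u 1"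

definition rb_gen :: "'a \<Rightarrow> ('a, 'k::field) rb" where
  "rb_gen x = rb_word [Gen x]"

definition rb_scale :: "'k \<Rightarrow> ('a, 'k::field) rb \<Rightarrow> ('a, 'k) rb" where
  "rb_scale c f = Poly_Mapping.map ((*) c) f"

definition rb_lift :: "('a word \<Rightarrow> ('b, 'k) rb) \<Rightarrow> ('a, 'k::field) rb \<Rightarrow> ('b, 'k) rb" where
  "rb_lift h f = (\<Sum>u\<in>Poly_Mapping.keys f. rb_scale (Poly_Mapping.lookup f u) (h u))"

definition rb_P :: "('a, 'k::field) rb \<Rightarrow> ('a, 'k) rb" where
  "rb_P = rb_lift (\<lambda>u. rb_word [Pw u])"

text \<open>
  The product of two primes and of two words, in the algebra of weight \<open>lam\<close>. The value for
  an empty word is irrelevant, since the empty word is not in \<^const>\<open>Phi\<close>.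
\<close>

function prime_mul :: "'k::field \<Rightarrow> 'a letter \<Rightarrow> 'a letter \<Rightarrow> ('a, 'k) rb"
  and word_mul :: "'k \<Rightarrow> 'a word \<Rightarrow> 'a word \<Rightarrow> ('a, 'k) rb" where
  "prime_mul lam (Pw u) (Pw v) =
     rb_P (word_mul lam [Pw u] v) + rb_P (word_mul lam u [Pw v])
     + rb_scale lam (rb_P (word_mul lam u v))"
| "prime_mul lam (Gen x) q = rb_word [Gen x, q]"
| "prime_mul lam (Pw u) (Gen y) = rb_word [Pw u, Gen y]"
| "word_mul lam u v =
     (if u = [] \<or> v = [] then 0
      else rb_lift (\<lambda>w. rb_word (butlast u @ w @ tl v)) (prime_mul lam (last u) (hd v)))"
  by pat_completeness auto

lemma size_last_less: "u \<noteq> [] \<Longrightarrow> size (last u) < size_list size u"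
  by (induction u) auto

lemma size_hd_less: "u \<noteq> [] \<Longrightarrow> size (hd u) < size_list size u"
  by (cases u) auto

termination
proof (relation "measure (\<lambda>t. case t of
        Inl (_, p, q) \<Rightarrow> size p + size q + 1
      | Inr (_, u, v) \<Rightarrow> size_list size u + size_list size v)", goal_cases)
  case (5 lam u v)
  then show ?case
    using size_last_less[of u] size_hd_less[of v] by auto
qed auto

definition rb_mul :: "'k \<Rightarrow> ('a, 'k::field) rb \<Rightarrow> ('a, 'k) rb \<Rightarrow> ('a, 'k) rb" where
  "rb_mul lam f g = rb_lift (\<lambda>u. rb_lift (\<lambda>v. word_mul lam u v) g) f"

text \<open>
  The leading word; meaningful for nonzero elements only.
\<close>

definition lead :: "('a::linorder, 'k::field) rb \<Rightarrow> 'a word" where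
  "lead f = (THE u. u \<in> Poly_Mapping.keys f \<and>
     (\<forall>v\<in>Poly_Mapping.keys f. v \<noteq> u \<longrightarrow> word_less v u))"

definition monic :: "('a::linorder, 'k::field) rb \<Rightarrow> bool" where
  "monic f \<longleftrightarrow> f \<noteq> 0 \<and> Poly_Mapping.lookup f (lead f) = 1"


section \<open>s-words\<close>

text \<open>The alphabet \<open>X \<union> {\<star>}\<close> is the option type, with \<^term>\<open>None\<close> for \<open>\<star>\<close>.\<close>

definition Phi_star :: "'a option word set" where
  "Phi_star = {u \<in> Phi. deg_gens {None} u = 1}"

text \<open>\<open>RB(X)\<close> is associative, so the bracketing of the product does not matter.\<close>

fun rb_prod :: "'k::field \<Rightarrow> ('a, 'k) rb list \<Rightarrow> ('a, 'k) rb" where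
  "rb_prod lam [] = 0"
| "rb_prod lam [f] = f"
| "rb_prod lam (f # g # fs) = rb_mul lam f (rb_prod lam (g # fs))"

primrec letter_subst :: "'k::field \<Rightarrow> ('a, 'k) rb \<Rightarrow> 'a option letter \<Rightarrow> ('a, 'k) rb" where
  "letter_subst lam s (Gen x) = (case x of None \<Rightarrow> s | Some y \<Rightarrow> rb_gen y)"
| "letter_subst lam s (Pw u) = rb_P (rb_prod lam (map (letter_subst lam s) u))"

text \<open>\<open>subst lam u s\<close> is \<open>u|\<^sub>s\<close>.\<close>

definition subst :: "'k::field \<Rightarrow> 'a option word \<Rightarrow> ('a, 'k) rb \<Rightarrow> ('a, 'k) rb" where
  "subst lam u s = rb_prod lam (map (letter_subst lam s) u)"

definition normal :: "'k::field \<Rightarrow> 'a::linorder option word \<Rightarrow> ('a, 'k) rb \<Rightarrow> bool" where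
  "normal lam u s \<longleftrightarrow>
     subst lam u s \<noteq> 0 \<and> rb_word (lead (subst lam u s)) = subst lam u (rb_word (lead s))"

definition star :: "'a option word" where
  "star = [Gen None]"

definition embed :: "'a word \<Rightarrow> 'a option word" where
  "embed = map (map_letter Some)"


section \<open>Compositions\<close>

text \<open>\<open>intersection_composition lam f g w h\<close>: \<open>h\<close> is an intersection composition \<open>(f, g)\<^sub>w\<close>.\<close>

definition intersection_composition ::
  "'k::field \<Rightarrow> ('a::linorder, 'k) rb \<Rightarrow> ('a, 'k) rb \<Rightarrow> 'a word \<Rightarrow> ('a, 'k) rb \<Rightarrow> bool" where
  "intersection_composition lam f g w h \<longleftrightarrow> monic f \<and> monic g \<and> w \<in> Phi \<and>
     (\<exists>a\<in>Phi. \<exists>b\<in>Phi. w = lead f @ a \<and> w = b @ lead g \<and>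
        normal lam (star @ embed a) f \<and> normal lam (embed b @ star) g \<and>
        deg_PX w < deg_PX (lead f) + deg_PX (lead g) \<and>
        h = rb_mul lam f (rb_word a) - rb_mul lam (rb_word b) g)"

definition inclusion_composition ::
  "'k::field \<Rightarrow> ('a::linorder, 'k) rb \<Rightarrow> ('a, 'k) rb \<Rightarrow> 'a word \<Rightarrow> ('a, 'k) rb \<Rightarrow> bool" where
  "inclusion_composition lam f g w h \<longleftrightarrow> monic f \<and> monic g \<and>
     (\<exists>u\<in>Phi_star. w = lead f \<and> rb_word w = subst lam u (rb_word (lead g)) \<and>
        h = f - subst lam u g)"

text \<open>
  For a normal s-word, \<open>u|\<close> applied to the leading word of \<open>s\<close> is a single word \<open>v\<close>.
\<close>

definition trivial_mod ::
  "'k::field \<Rightarrow> ('a::linorder, 'k) rb set \<Rightarrow> 'a word \<Rightarrow> ('a, 'k) rb \<Rightarrow> bool" where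
  "trivial_mod lam S w h \<longleftrightarrow>
     (\<exists>ts. h = (\<Sum>(\<alpha>, u, s)\<leftarrow>ts. rb_scale \<alpha> (subst lam u s)) \<and>
        (\<forall>(\<alpha>, u, s)\<in>set ts. s \<in> S \<and> u \<in> Phi_star \<and> normal lam u s \<and>
           (\<exists>v. rb_word v = subst lam u (rb_word (lead s)) \<and> word_less v w)))"


section \<open>The relations of the enveloping algebra of a dendriform dialgebra\<close>

text \<open>
  \<open>of_dend scale x d\<close> is the element \<open>d\<close> of \<open>D\<close>, expanded in the basis \<open>x\<close> and read in \<open>RB(X)\<close>.
\<close>

definition of_dend ::
  "('k::field \<Rightarrow> 'd::ab_group_add \<Rightarrow> 'd) \<Rightarrow> ('i \<Rightarrow> 'd) \<Rightarrow> 'd \<Rightarrow> ('i, 'k) rb" where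
  "of_dend scale x d =
     (\<Sum>n | module.representation scale (range x) d (x n) \<noteq> 0.
        rb_scale (module.representation scale (range x) d (x n)) (rb_gen n))"

definition dend_relations ::
  "'k::field \<Rightarrow> ('k \<Rightarrow> 'd::ab_group_add \<Rightarrow> 'd) \<Rightarrow> ('d \<Rightarrow> 'd \<Rightarrow> 'd) \<Rightarrow> ('d \<Rightarrow> 'd \<Rightarrow> 'd) \<Rightarrow>
    ('i \<Rightarrow> 'd) \<Rightarrow> ('i, 'k) rb set" where
  "dend_relations lam scale prec succ x =
    (let mul = rb_mul lam;
         gen = rb_gen;
         prec_bracket = (\<lambda>i j. of_dend scale x (prec (x i) (x j)));
         succ_bracket = (\<lambda>i j. of_dend scale x (succ (x i) (x j)))
     in {mul (gen i) (rb_P (gen j)) + rb_scale lam (mul (gen i) (gen j)) - prec_bracket i j | i j. True}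
      \<union> {mul (rb_P (gen i)) (gen j) - succ_bracket i j | i j. True}
      \<union> {mul (mul (gen i) (gen j)) (gen l)
           - rb_scale (inverse lam) (mul (prec_bracket i j) (gen l))
           + rb_scale (inverse lam) (mul (gen i) (succ_bracket j l)) | i j l. True})"


section \<open>\<open>RB(X)\<close> is closed under the operations\<close>

lemma Phi_level_mono: "(Phi_level n :: 'a word set) \<subseteq> Phi_level (Suc n)"
proof (induction n)
  case 0
  have "successively (\<lambda>p q. \<not> (p \<in> range Pw \<and> q \<in> range Pw)) u"
    if "set u \<subseteq> range Gen" for u :: "'a word"
    using that by (induction u rule: induct_list012) auto
  then show ?case by auto
next
  case (Suc n)
  have "range Gen \<union> Pw ` (Phi_level n :: 'a word set) \<subseteq> range Gen \<union> Pw ` Phi_level (Suc n)"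
    by (rule Un_mono[OF order_refl image_mono[OF Suc.IH]])
  then show ?case
    unfolding Phi_level.simps(2) by (intro Collect_mono) (meson order.trans)
qed

lemma Phi_level_mono': "m \<le> n \<Longrightarrow> Phi_level m \<subseteq> Phi_level n"
  using lift_Suc_mono_le[of Phi_level, OF Phi_level_mono] .

lemma Phi_iff: "u \<in> Phi \<longleftrightarrow> u \<noteq> [] \<and> set u \<subseteq> range Gen \<union> Pw ` Phi \<and>
    successively (\<lambda>p q. \<not> (p \<in> range Pw \<and> q \<in> range Pw)) u" (is "_ \<longleftrightarrow> ?R")
proof
  assume "u \<in> Phi"
  then obtain n where "u \<in> Phi_level n" by (auto simp: Phi_def)
  then have "u \<in> Phi_level (Suc n)" using Phi_level_mono by blast
  then show ?R unfolding Phi_def Phi_level.simps by blast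
next
  assume R: ?R
  have "\<exists>n. A \<subseteq> range Gen \<union> Pw ` Phi_level n" if "finite A" "A \<subseteq> range Gen \<union> Pw ` (Phi :: 'a word set)" for A
    using that
  proof (induction A)
    case (insert p A)
    then obtain n where n: "A \<subseteq> range Gen \<union> Pw ` Phi_level n" by auto
    obtain m where m: "p \<in> range Gen \<union> Pw ` Phi_level m" using insert.prems by (auto simp: Phi_def)
    have mono: "range Gen \<union> Pw ` Phi_level k \<subseteq> range Gen \<union> Pw ` Phi_level (max n m)"
      if "k \<le> max n m" for k
      by (rule Un_mono[OF order_refl image_mono[OF Phi_level_mono'[OF that]]])
    have "insert p A \<subseteq> range Gen \<union> Pw ` Phi_level (max n m)"
      by (rule insert_subsetI[OF subsetD[OF mono[OF max.cobounded2] m]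
            order.trans[OF n mono[OF max.cobounded1]]])
    then show ?case by blast
  qed auto
  from this[of "set u"] R obtain n where "set u \<subseteq> range Gen \<union> Pw ` Phi_level n"
    by blast
  with R have "u \<in> Phi_level (Suc n)"
    by simp
  then show "u \<in> Phi" unfolding Phi_def by blast
qed

lemma RB_add: "f \<in> RB \<Longrightarrow> g \<in> RB \<Longrightarrow> f + g \<in> RB"
  using keys_add[of f g] by (auto simp: RB_def)
lemma RB_diff: "f \<in> RB \<Longrightarrow> g \<in> RB \<Longrightarrow> f - g \<in> RB"
  using keys_diff[of f g] by (auto simp: RB_def)
lemma RB_sum: "(\<And>i. i \<in> A \<Longrightarrow> f i \<in> RB) \<Longrightarrow> sum f A \<in> RB"
  by (induction A rule: infinite_finite_induct) (auto intro: RB_add, auto simp: RB_def)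
lemma RB_scale: "f \<in> RB \<Longrightarrow> rb_scale c f \<in> RB"
  by (auto simp: RB_def rb_scale_def in_keys_iff map.rep_eq when_def split: if_splits)
lemma RB_word: "u \<in> Phi \<Longrightarrow> rb_word u \<in> RB"
  by (auto simp: RB_def rb_word_def)
lemma RB_lift: "f \<in> RB \<Longrightarrow> (\<And>u. u \<in> Phi \<Longrightarrow> h u \<in> RB) \<Longrightarrow> rb_lift h f \<in> RB"
  unfolding rb_lift_def by (intro RB_sum RB_scale) (auto simp: RB_def)

lemma Phi_single [simp]: "[Gen x] \<in> Phi" "[Pw u] \<in> Phi \<longleftrightarrow> u \<in> Phi"
  by (subst Phi_iff; auto)+
lemma RB_P: "f \<in> RB \<Longrightarrow> rb_P f \<in> RB"
  unfolding rb_P_def by (intro RB_lift RB_word) auto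

definition ends :: "'a letter \<Rightarrow> 'a letter \<Rightarrow> 'a word \<Rightarrow> bool" where
  "ends p q w \<longleftrightarrow> w \<noteq> [] \<and> (hd w \<in> range Pw \<longrightarrow> p \<in> range Pw) \<and> (last w \<in> range Pw \<longrightarrow> q \<in> range Pw)"

lemma RB_prime_mul_word_mul:
  fixes lam :: "'k::field"
    and p q :: "'a letter" and u v :: "'a word"
  shows "[p] \<in> Phi \<Longrightarrow> [q] \<in> Phi \<Longrightarrow> prime_mul lam p q \<in> RB \<and> (\<forall>w\<in>Poly_Mapping.keys (prime_mul lam p q). ends p q w)"
  and "u \<in> Phi \<Longrightarrow> v \<in> Phi \<Longrightarrow> word_mul lam u v \<in> RB"
proof (induction lam p q and lam u v rule: prime_mul_word_mul.induct)
  case (1 lam u v)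
  have k: "w \<in> range (\<lambda>u. [Pw u])" if "w \<in> Poly_Mapping.keys (rb_P f)" for w and f :: "('a,'k) rb"
  proof -
    have "Poly_Mapping.keys (rb_P f) \<subseteq> range (\<lambda>u. [Pw u])"
      unfolding rb_P_def rb_lift_def rb_scale_def rb_word_def
      by (rule order.trans[OF keys_sum]) (auto simp: in_keys_iff map.rep_eq lookup_single when_def split: if_splits)
    with that show ?thesis by blast
  qed
  have s: "Poly_Mapping.keys (rb_scale lam f) \<subseteq> Poly_Mapping.keys f" for f :: "('a,'k) rb"
    by (auto simp: rb_scale_def in_keys_iff map.rep_eq when_def split: if_splits)
  have "prime_mul lam (Pw u) (Pw v) \<in> RB"
    using 1 by (auto intro!: RB_add RB_scale RB_P)
  moreover have "ends (Pw u) (Pw v) w" if "w \<in> Poly_Mapping.keys (prime_mul lam (Pw u) (Pw v))" for w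
  proof -
    have "w \<in> range (\<lambda>u. [Pw u])"
      using that unfolding prime_mul.simps using keys_add s k by (metis (no_types, lifting) Un_iff subsetD)
    then show ?thesis by (auto simp: ends_def)
  qed
  ultimately show ?case by blast
next
  case (2 lam x q)
  have "[Gen x, q] \<in> Phi" using 2 by (subst Phi_iff, subst (asm) (2) Phi_iff) auto
  then show ?case by (auto intro: RB_word simp: ends_def) (auto simp: rb_word_def)
next
  case (3 lam u y)
  have "[Pw u, Gen y] \<in> Phi" using 3 by (subst Phi_iff) auto
  then show ?case by (auto intro: RB_word simp: ends_def) (auto simp: rb_word_def)
next
  case (4 lam u v)
  then have ne: "u \<noteq> []" "v \<noteq> []" by (auto simp: Phi_iff[of u] Phi_iff[of v])
  define p q where "p = last u" and "q = hd v"
  define u' v' where "u' = butlast u" and "v' = tl v"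
  have u: "u = u' @ [p]" and v: "v = q # v'" using ne by (auto simp: p_def q_def u'_def v'_def)
  let ?S = "successively (\<lambda>p q. \<not> (p \<in> range Pw \<and> q \<in> range Pw))"
  have pq: "[p] \<in> Phi" "[q] \<in> Phi"
    using 4(2,3) unfolding u v Phi_iff[of "u' @ [p]"] Phi_iff[of "q # v'"] by (auto)
  have IH: "prime_mul lam p q \<in> RB" "\<And>w. w\<in>Poly_Mapping.keys (prime_mul lam p q) \<Longrightarrow> ends p q w"
    using 4(1) ne pq unfolding p_def q_def by auto
  have "u' @ w @ v' \<in> Phi" if "w \<in> Phi" "ends p q w" for w
    using 4(2,3) that unfolding u v Phi_iff[of "u' @ [p]"] Phi_iff[of "q # v'"] Phi_iff[of w] Phi_iff[of "u' @ w @ v'"]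
    by (cases v') (auto simp: successively_append_iff ends_def successively_Cons)
  then show ?case using IH unfolding word_mul.simps rb_lift_def p_def[symmetric] q_def[symmetric] u'_def[symmetric] v'_def[symmetric]
    by (auto simp: ne intro!: RB_sum RB_scale RB_word) (auto simp: RB_def)
qed

lemma RB_mul: "f \<in> RB \<Longrightarrow> g \<in> RB \<Longrightarrow> rb_mul lam f g \<in> RB"
  unfolding rb_mul_def by (intro RB_lift RB_prime_mul_word_mul(2))

lemma RB_gen: "rb_gen x \<in> RB"
  unfolding rb_gen_def by (intro RB_word) auto

lemma RB_of_dend: "of_dend scale x d \<in> RB"
  unfolding of_dend_def by (intro RB_sum RB_scale RB_gen)

lemma dend_relations_subset_RB: "dend_relations lam scale prec succ x \<subseteq> RB"
  unfolding dend_relations_def Let_def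
  by (auto intro!: RB_add RB_diff RB_scale RB_mul RB_P RB_gen RB_of_dend)

end

theory Submission
  imports Defs
begin

text \<open>
  Write \<open>r\<^sub>1(a, b)\<close>, \<open>r\<^sub>2(a, b)\<close>, \<open>r\<^sub>3(a, b, c)\<close> for the three kinds of relations. These expressions
  are multilinear, so they make sense for arbitrary elements of the dialgebra, and none of the
  products involved has two adjacent \<open>P\<close>-factors: the computation takes place in the algebra
  of words under concatenation. The overlaps of the leading words are
  \<open>xP(x)x\<close>, \<open>P(x)xP(x)\<close>, \<open>P(x)xxx\<close>, \<open>xxxP(x)\<close>, \<open>xxxx\<close> and \<open>xxxxx\<close>. For each of them the dendriform
  axioms give an identity that expresses the composition by relations \<open>r\<^sub>i\<close>, multiplied by at
  most one generator, of total degree smaller than that of \<open>w\<close>. Expanding the arguments in the basis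
  turns these into normal \<open>s\<close>-words.
  An inclusion composition with \<open>u \<noteq> \<star>\<close> is impossible: multiplication preserves the number of
  generators and does not remove all occurrences of \<open>P\<close>.
\<close>

section \<open>Linear maps on words\<close>

lemma lookup_rb_scale [simp]: "Poly_Mapping.lookup (rb_scale c f) u = c * Poly_Mapping.lookup f u"
  by (simp add: rb_scale_def map.rep_eq when_def)

lemma lookup_rb_word: "Poly_Mapping.lookup (rb_word u) v = (1 when u = v)"
  by (simp add: rb_word_def lookup_single)

interpretation rb: module "rb_scale :: 'k::field \<Rightarrow> ('a, 'k) rb \<Rightarrow> ('a, 'k) rb"
  by unfold_locales (auto intro!: poly_mapping_eqI simp: lookup_add algebra_simps)

text \<open>Elements with different supports can thus be summed over one common finite set, which
  makes additivity of \<open>rb_lift\<close> a termwise matter.\<close>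

lemma rb_lift_superset:
  assumes "finite A" "Poly_Mapping.keys f \<subseteq> A"
  shows "rb_lift h f = (\<Sum>u\<in>A. rb_scale (Poly_Mapping.lookup f u) (h u))"
  unfolding rb_lift_def
  by (rule sum.mono_neutral_left) (use assms in \<open>auto simp: in_keys_iff\<close>)

lemma lookup_rb_lift:
  "Poly_Mapping.lookup (rb_lift h f) w
    = (\<Sum>u\<in>Poly_Mapping.keys f. Poly_Mapping.lookup f u * Poly_Mapping.lookup (h u) w)"
  by (simp add: rb_lift_def lookup_sum)

lemma rb_lift_hom: "module_hom rb_scale rb_scale (rb_lift h)"
proof (unfold_locales, goal_cases)
  case (1 f g)
  let ?A = "Poly_Mapping.keys f \<union> Poly_Mapping.keys g"
  show ?case
    using keys_add[of f g]
    by (simp add: rb_lift_superset[of ?A] lookup_add rb.scale_left_distrib sum.distrib)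
next
  case (2 c f)
  have "Poly_Mapping.keys (rb_scale c f) \<subseteq> Poly_Mapping.keys f"
    by (auto simp: in_keys_iff)
  then show ?case
    by (simp add: rb_lift_superset[of "Poly_Mapping.keys f"] rb.scale_sum_right)
qed

lemma rb_lift_word [simp]: "rb_lift h (rb_word u) = h u"
  by (simp add: rb_lift_def rb_word_def)

lemma rb_lift_rb_lift: "rb_lift h (rb_lift k f) = rb_lift (\<lambda>u. rb_lift h (k u)) f"
proof -
  interpret module_hom rb_scale rb_scale "rb_lift h" by (rule rb_lift_hom)
  show ?thesis unfolding rb_lift_def[of k] rb_lift_def[of "\<lambda>u. rb_lift h (k u)"]
    by (simp add: sum scale)
qed

lemma rb_lift_cong:
  "(\<And>u. u \<in> Poly_Mapping.keys f \<Longrightarrow> h u = k u) \<Longrightarrow> rb_lift h f = rb_lift k f"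
  by (simp add: rb_lift_def)

lemma rb_lift_rb_word [simp]: "rb_lift rb_word f = f"
  by (rule poly_mapping_eqI)
    (auto simp: lookup_rb_lift lookup_rb_word when_def in_keys_iff if_distrib sum.delta
      cong: if_cong)

lemma rb_P_hom: "module_hom rb_scale rb_scale rb_P"
  unfolding rb_P_def by (rule rb_lift_hom)

lemma rb_P_word [simp]: "rb_P (rb_word u) = rb_word [Pw u]"
  by (simp add: rb_P_def)


section \<open>Elements supported on a set of words\<close>

text \<open>One notion for all support conditions used below: degree bounds, nonemptiness, type of
  the first or last letter. \<open>RB\<close> is the case \<open>A = Phi\<close>.\<close>

definition rb_on :: "'a word set \<Rightarrow> ('a, 'k::field) rb set" where
  "rb_on A = {f. Poly_Mapping.keys f \<subseteq> A}"

lemma Nil_notin_Phi [simp]: "[] \<notin> Phi"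
  by (simp add: Phi_iff[of "[]"])

lemma rb_on_mono: "f \<in> rb_on A \<Longrightarrow> A \<subseteq> B \<Longrightarrow> f \<in> rb_on B"
  by (auto simp: rb_on_def)

lemma rb_on_zero [simp]: "0 \<in> rb_on A"
  by (simp add: rb_on_def)

lemma rb_on_add: "f \<in> rb_on A \<Longrightarrow> g \<in> rb_on A \<Longrightarrow> f + g \<in> rb_on A"
  using keys_add[of f g] by (auto simp: rb_on_def)

lemma rb_on_diff: "f \<in> rb_on A \<Longrightarrow> g \<in> rb_on A \<Longrightarrow> f - g \<in> rb_on A"
  using keys_diff[of f g] by (auto simp: rb_on_def)

lemma rb_on_scale: "f \<in> rb_on A \<Longrightarrow> rb_scale c f \<in> rb_on A"
  by (auto simp: rb_on_def in_keys_iff)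

lemma rb_on_sum: "(\<And>i. i \<in> I \<Longrightarrow> f i \<in> rb_on A) \<Longrightarrow> sum f I \<in> rb_on A"
  by (induction I rule: infinite_finite_induct) (auto intro: rb_on_add)

lemma rb_on_word [simp]: "rb_word u \<in> rb_on A \<longleftrightarrow> u \<in> A"
  by (simp add: rb_on_def rb_word_def)

lemma rb_word_inject [simp]: "(rb_word u :: ('a, 'k::field) rb) = rb_word v \<longleftrightarrow> u = v"
  by (metis rb_on_word singleton_iff)

lemma rb_on_lift:
  "f \<in> rb_on A \<Longrightarrow> (\<And>u. u \<in> A \<Longrightarrow> h u \<in> rb_on B) \<Longrightarrow> rb_lift h f \<in> rb_on B"
  unfolding rb_lift_def by (intro rb_on_sum rb_on_scale) (auto simp: rb_on_def)

lemma rb_on_P: "f \<in> rb_on A \<Longrightarrow> (\<And>u. u \<in> A \<Longrightarrow> [Pw u] \<in> B) \<Longrightarrow> rb_P f \<in> rb_on B"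
  unfolding rb_P_def by (erule rb_on_lift) simp

lemma rb_on_mul:
  "f \<in> rb_on A \<Longrightarrow> g \<in> rb_on B \<Longrightarrow>
    (\<And>u v. u \<in> A \<Longrightarrow> v \<in> B \<Longrightarrow> word_mul lam u v \<in> rb_on C) \<Longrightarrow> rb_mul lam f g \<in> rb_on C"
  unfolding rb_mul_def by (auto intro!: rb_on_lift)


section \<open>Degrees\<close>

declare word_mul.simps [simp del]

lemma deg_gens_simps [simp]:
  "deg_gens Y [] = 0" "deg_gens Y (p # u) = letter_gens Y p + deg_gens Y u"
  "deg_gens Y (u @ v) = deg_gens Y u + deg_gens Y v"
  by (simp_all add: deg_gens_def)

lemma deg_P_simps [simp]:
  "deg_P [] = 0" "deg_P (p # u) = letter_ops p + deg_P u" "deg_P (u @ v) = deg_P u + deg_P v"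
  by (simp_all add: deg_P_def)

lemma letter_Pw_simps [simp]:
  "letter_gens Y (Pw u) = deg_gens Y u" "letter_ops (Pw u) = Suc (deg_P u)"
  by (simp_all add: deg_gens_def deg_P_def)

declare letter_gens.simps(2) [simp del] letter_ops.simps(2) [simp del]

lemma deg_PX_append [simp]: "deg_PX (u @ v) = deg_PX u + deg_PX v"
  by (simp add: deg_PX_def)

lemma deg_map_Gen [simp]:
  "deg_gens UNIV (map Gen ys) = length ys" "deg_P (map Gen ys) = 0"
  "deg_PX (map Gen ys) = length ys"
  by (induction ys) (simp_all add: deg_PX_def)

text \<open>If \<open>v\<close> began at or after the end of \<open>u\<close>, additivity of
  \<open>deg_PX\<close> would contradict the strict bound. So the degree condition of an
  intersection composition forces a genuine overlap \<open>c\<close>.\<close>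

lemma overlap:
  assumes "u @ a = b @ v" "deg_PX (u @ a) < deg_PX u + deg_PX v"
  obtains c where "u = b @ c" "v = c @ a" "c \<noteq> []"
proof -
  from assms(1) consider c where "u = b @ c" "v = c @ a" | c where "b = u @ c" "a = c @ v"
    by (auto simp: append_eq_append_conv2)
  then show thesis
  proof cases
    case 1
    then show thesis using assms(2) that by (cases "c = []") auto
  next
    case 2
    then show thesis using assms(2) by simp
  qed
qed

lemma letter_gens_disjoint_union:
  "A \<inter> B = {} \<Longrightarrow> letter_gens (A \<union> B) p = letter_gens A p + letter_gens B p"
proof (induction p)
  case (Pw u)
  then have "deg_gens (A \<union> B) u = deg_gens A u + deg_gens B u"
    by (induction u) auto
  then show ?case by simp
qed auto

lemma deg_gens_disjoint_union:
  "A \<inter> B = {} \<Longrightarrow> deg_gens (A \<union> B) u = deg_gens A u + deg_gens B u"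
  by (induction u) (simp_all add: letter_gens_disjoint_union)

text \<open>In \<open>Phi\<close> no argument of \<open>P\<close> is empty, so descending into
  nested arguments always reaches a generator.\<close>

lemma letter_gens_pos: "[p] \<in> Phi \<Longrightarrow> 0 < letter_gens UNIV p"
proof (induction p)
  case (Pw u)
  then have "u \<in> Phi" by simp
  then obtain q where "q \<in> set u" "[q] \<in> Phi"
    using Phi_iff[of u] by (cases u) (fastforce, fastforce)
  with Pw.IH show ?case
    by (fastforce simp: deg_gens_def member_le_sum_list dest: split_list)
qed simp

lemma length_le_deg_gens: "u \<in> Phi \<Longrightarrow> length u \<le> deg_gens UNIV u"
proof -
  have "length u \<le> deg_gens UNIV u" if "\<And>p. p \<in> set u \<Longrightarrow> [p] \<in> Phi" for u :: "'a word"
    using that by (induction u) (fastforce dest: letter_gens_pos)+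
  moreover assume "u \<in> Phi"
  then have "[p] \<in> Phi" if "p \<in> set u" for p
    using that by (auto simp: Phi_iff[of u])
  ultimately show ?thesis .
qed

text \<open>The Rota-Baxter rule keeps every generator, but its term with factor \<open>lam\<close>
  merges two occurrences of \<open>P\<close> into one. So the count of generators is exact, whereas
  the number of \<open>P\<close> is only bounded below by the larger of the two counts.\<close>

lemma prime_mul_word_mul_degrees:
  fixes lam :: "'k::field" and p q :: "'a letter" and u v :: "'a word"
  shows "prime_mul lam p q \<in> rb_on {w. deg_gens UNIV w = letter_gens UNIV p + letter_gens UNIV q
            \<and> letter_ops p \<le> deg_P w \<and> letter_ops q \<le> deg_P w}"
    and "word_mul lam u v \<in> rb_on {w. deg_gens UNIV w = deg_gens UNIV u + deg_gens UNIV v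
            \<and> deg_P u \<le> deg_P w \<and> deg_P v \<le> deg_P w}"
proof (induction lam p q and lam u v rule: prime_mul_word_mul.induct)
  case (1 lam u v)
  then show ?case
    unfolding prime_mul.simps by (intro rb_on_add rb_on_scale) (erule rb_on_P, force)+
next
  case (4 lam u v)
  show ?case
  proof (cases "u = [] \<or> v = []")
    case False
    then obtain u' p v' q where uv: "u = u' @ [p]" "v = q # v'"
      by (metis neq_Nil_conv rev_exhaust)
    with 4 False have IH: "prime_mul lam p q
        \<in> rb_on {w. deg_gens UNIV w = letter_gens UNIV p + letter_gens UNIV q
            \<and> letter_ops p \<le> deg_P w \<and> letter_ops q \<le> deg_P w}"
      by simp
    show ?thesis
      using False by (simp add: uv word_mul.simps) (auto intro!: rb_on_lift[OF IH])
  qed (auto simp: word_mul.simps)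
qed simp_all


section \<open>Concatenation\<close>

text \<open>The product of the free associative algebra on letters, with unit
  \<open>rb_word []\<close>. It may leave \<open>Phi\<close>, but it is plainly associative and
  agrees with \<open>rb_mul\<close> as long as no two \<open>P\<close>-factors meet.\<close>

definition conc :: "('a, 'k::field) rb \<Rightarrow> ('a, 'k) rb \<Rightarrow> ('a, 'k) rb" (infixl \<open>\<odot>\<close> 75) where
  "f \<odot> g = rb_lift (\<lambda>u. rb_lift (\<lambda>v. rb_word (u @ v)) g) f"

lemma conc_hom_left: "module_hom rb_scale rb_scale (\<lambda>f. f \<odot> g)"
  unfolding conc_def by (rule rb_lift_hom)

text \<open>Not commutativity of \<open>\<odot>\<close>: the two finite sums are exchanged, so that
  linearity in the second argument is again an instance of \<open>rb_lift_hom\<close>.\<close>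

lemma conc_commute: "f \<odot> g = rb_lift (\<lambda>v. rb_lift (\<lambda>u. rb_word (u @ v)) f) g"
  unfolding conc_def rb_lift_def
  by (simp add: rb.scale_sum_right mult.commute) (rule sum.swap)

lemma conc_hom_right: "module_hom rb_scale rb_scale (\<lambda>g. f \<odot> g)"
  unfolding conc_commute by (rule rb_lift_hom)

lemmas hom_simps =
  module_hom.add[OF conc_hom_left] module_hom.add[OF conc_hom_right] module_hom.add[OF rb_P_hom]
  module_hom.diff[OF conc_hom_left] module_hom.diff[OF conc_hom_right] module_hom.diff[OF rb_P_hom]
  module_hom.neg[OF conc_hom_left] module_hom.neg[OF conc_hom_right] module_hom.neg[OF rb_P_hom]
  module_hom.scale[OF conc_hom_left] module_hom.scale[OF conc_hom_right] module_hom.scale[OF rb_P_hom]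

lemma conc_words [simp]: "rb_word u \<odot> rb_word v = rb_word (u @ v)"
  by (simp add: conc_def)

lemma conc_word_left: "rb_word p \<odot> f = rb_lift (\<lambda>u. rb_word (p @ u)) f"
  by (simp add: conc_def)

lemma conc_word_right: "f \<odot> rb_word q = rb_lift (\<lambda>u. rb_word (u @ q)) f"
  by (simp add: conc_def)

lemma conc_Nil [simp]: "rb_word [] \<odot> f = f" "f \<odot> rb_word [] = f"
  by (simp_all add: conc_word_left conc_word_right)

lemma conc_assoc: "f \<odot> g \<odot> h = f \<odot> (g \<odot> h)"
  by (simp add: conc_def rb_lift_rb_lift)

lemma rb_on_conc:
  "f \<in> rb_on A \<Longrightarrow> g \<in> rb_on B \<Longrightarrow> (\<And>u v. u \<in> A \<Longrightarrow> v \<in> B \<Longrightarrow> u @ v \<in> C) \<Longrightarrow> f \<odot> g \<in> rb_on C"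
  unfolding conc_def by (auto intro!: rb_on_lift)

lemma word_mul_eq_append:
  assumes "u \<noteq> []" "v \<noteq> []" "last u \<in> range Gen \<or> hd v \<in> range Gen"
  shows "word_mul lam u v = rb_word (u @ v)"
proof -
  have "prime_mul lam (last u) (hd v) = rb_word [last u, hd v]"
    using assms(3) by (cases "last u") auto
  moreover have "butlast u @ [last u, hd v] @ tl v = (butlast u @ [last u]) @ (hd v # tl v)"
    by simp
  ultimately show ?thesis using assms(1,2)
    by (simp only: word_mul.simps rb_lift_word append_butlast_last_id list.collapse) simp
qed

lemma rb_mul_eq_conc:
  assumes "f \<in> rb_on {u. u \<noteq> []}" "g \<in> rb_on {u. u \<noteq> []}"
    and "f \<in> rb_on {u. last u \<in> range Gen} \<or> g \<in> rb_on {u. hd u \<in> range Gen}"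
  shows "rb_mul lam f g = f \<odot> g"
  unfolding rb_mul_def conc_def
  using assms by (intro rb_lift_cong word_mul_eq_append) (auto simp: rb_on_def)


section \<open>Leading words\<close>

text \<open>Each rule of \<open>word_less\<close> compares words of equal \<open>Deg\<close> or
  increases \<open>Deg\<close>, whose first component is \<open>deg_PX\<close>. This serves in place
  of antisymmetry when the leading word is shown to be unique.\<close>

lemma word_less_deg_PX_le: "word_less u v \<Longrightarrow> deg_PX u \<le> deg_PX v"
  by (cases rule: word_less.cases) (auto simp: Deg_def deg_PX_def)

lemma word_less_of_deg_PX: "deg_PX u < deg_PX v \<Longrightarrow> word_less u v"
  by (intro word_less.deg) (auto simp: Deg_def)

text \<open>
  In every relation of the theorem the leading word is already singled out by its total degree.
\<close>

definition top_word :: "('a, 'k::field) rb \<Rightarrow> 'a word \<Rightarrow> bool" where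
  "top_word s t \<longleftrightarrow> t \<in> Poly_Mapping.keys s \<and>
     (\<forall>v\<in>Poly_Mapping.keys s. v \<noteq> t \<longrightarrow> deg_PX v < deg_PX t)"

lemma lead_eq_top_word:
  fixes s :: "('a::linorder, 'k::field) rb"
  assumes "top_word s t"
  shows "lead s = t"
  unfolding lead_def
proof (rule the_equality)
  show "t \<in> Poly_Mapping.keys s \<and> (\<forall>v\<in>Poly_Mapping.keys s. v \<noteq> t \<longrightarrow> word_less v t)"
    using assms by (auto simp: top_word_def intro: word_less_of_deg_PX)
next
  fix u assume u: "u \<in> Poly_Mapping.keys s \<and> (\<forall>v\<in>Poly_Mapping.keys s. v \<noteq> u \<longrightarrow> word_less v u)"
  show "u = t"
  proof (rule ccontr)
    assume "u \<noteq> t"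
    with assms u have "deg_PX u < deg_PX t" "word_less t u"
      by (simp_all add: top_word_def)
    then show False
      using word_less_deg_PX_le[of t u] by simp
  qed
qed

lemma top_wordI:
  assumes "r \<in> rb_on {v. deg_PX v < deg_PX t}"
  shows "top_word (rb_word t + r) t"
proof -
  have "Poly_Mapping.lookup r t = 0"
    using assms by (auto simp: rb_on_def in_keys_iff)
  then show ?thesis
    using assms unfolding top_word_def rb_on_def
    by (auto simp: in_keys_iff lookup_add lookup_rb_word when_def split: if_splits)
qed

text \<open>Passing from \<open>v\<close> to \<open>p @ v @ q\<close> is injective and shifts
  \<open>deg_PX\<close> by a constant. So no terms merge and the top word stays on top; this is the
  source of normality of \<open>s\<close>-words.\<close>

lemma top_word_conc:
  assumes "top_word s t"
  shows "top_word (rb_word p \<odot> s \<odot> rb_word q) (p @ t @ q)"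
proof -
  have eq: "rb_word p \<odot> s \<odot> rb_word q = rb_lift (\<lambda>v. rb_word (p @ v @ q)) s" (is "_ = ?f")
    by (simp add: conc_word_left conc_word_right rb_lift_rb_lift)
  have l: "Poly_Mapping.lookup ?f (p @ v @ q) = Poly_Mapping.lookup s v" for v
    by (auto simp: lookup_rb_lift lookup_rb_word when_def in_keys_iff if_distrib sum.delta
      cong: if_cong)
  have "?f \<in> rb_on ((\<lambda>v. p @ v @ q) ` Poly_Mapping.keys s)"
    by (rule rb_on_lift[of _ "Poly_Mapping.keys s"]) (auto simp: rb_on_def[of "Poly_Mapping.keys s"])
  then have "Poly_Mapping.keys ?f \<subseteq> (\<lambda>v. p @ v @ q) ` Poly_Mapping.keys s"
    by (simp add: rb_on_def)
  moreover have "p @ t @ q \<in> Poly_Mapping.keys ?f"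
    using assms l[of t] by (simp add: top_word_def in_keys_iff)
  moreover have "deg_PX (p @ v @ q) < deg_PX (p @ t @ q)" if "v \<in> Poly_Mapping.keys s" "v \<noteq> t" for v
    using assms that by (simp add: top_word_def)
  ultimately show ?thesis
    unfolding eq top_word_def by blast
qed


section \<open>Substitution into words\<close>

lemma rb_prod_gens: "zs \<noteq> [] \<Longrightarrow> rb_prod lam (map rb_gen zs) = rb_word (map Gen zs)"
proof (induction zs rule: induct_list012)
  case (3 y z zs)
  then show ?case
    by (simp add: rb_gen_def rb_mul_eq_conc)
qed (simp_all add: rb_gen_def)

text \<open>All neighbours of \<open>s\<close> are generators, so no two \<open>P\<close>-factors
  meet, whatever the words in \<open>s\<close> are.\<close>

lemma rb_prod_context:
  assumes "s \<in> rb_on {u. u \<noteq> []}"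
  shows "rb_prod lam (map rb_gen ys @ s # map rb_gen zs)
     = rb_word (map Gen ys) \<odot> s \<odot> rb_word (map Gen zs)"
proof (induction ys)
  case Nil
  show ?case
  proof (cases zs)
    case (Cons z zs')
    then show ?thesis
      using assms rb_prod_gens[of "z # zs'" lam] by (simp add: rb_mul_eq_conc)
  qed simp
next
  case (Cons y ys)
  let ?r = "rb_word (map Gen ys) \<odot> s \<odot> rb_word (map Gen zs)"
  have "?r \<in> rb_on {u. u \<noteq> []}"
    by (rule rb_on_conc[OF rb_on_conc[OF _ assms, where A = UNIV and C = "{u. u \<noteq> []}"], where B = UNIV])
      auto
  then have "rb_mul lam (rb_gen y) ?r = rb_word (map Gen (y # ys)) \<odot> s \<odot> rb_word (map Gen zs)"
    by (simp add: rb_mul_eq_conc rb_gen_def flip: conc_assoc)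
  \<comment> \<open>The recursion of \<open>rb_prod\<close> needs a visible second element, hence
    the case split on \<open>ys\<close>.\<close>
  then show ?case
    using Cons by (cases ys) auto
qed

lemma subst_context:
  assumes "s \<in> rb_on {u. u \<noteq> []}"
  shows "subst lam (embed (map Gen ys) @ star @ embed (map Gen zs)) s
     = rb_word (map Gen ys) \<odot> s \<odot> rb_word (map Gen zs)"
  using rb_prod_context[OF assms, of lam ys zs]
  by (simp add: subst_def star_def embed_def comp_def)

lemma context_in_Phi_star: "embed (map Gen ys) @ star @ embed (map Gen zs) \<in> Phi_star"
proof -
  let ?u = "embed (map Gen ys) @ star @ embed (map Gen zs)"
  have "?u \<in> Phi_level 0"
    by (auto simp: star_def embed_def)
  moreover have "deg_gens {None} (embed (map Gen zs)) = 0" for zs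
    by (induction zs) (auto simp: embed_def)
  ultimately show ?thesis
    unfolding Phi_star_def Phi_def by (auto simp del: Phi_level.simps simp: star_def)
qed

text \<open>The map \<open>h\<close> is arbitrary so that the lemma also applies inside the
  induction over letters, where the claim is known only for the letters of an argument of
  \<open>P\<close>.\<close>

lemma rb_prod_degree:
  assumes "\<And>p. p \<in> set u \<Longrightarrow>
    h p \<in> rb_on {w. deg_gens UNIV w = n * letter_gens {None} p + letter_gens (range Some) p}"
  shows "rb_prod lam (map h u)
    \<in> rb_on {w. deg_gens UNIV w = n * deg_gens {None} u + deg_gens (range Some) u}"
  using assms
proof (induction u rule: induct_list012)
  case (3 p q u)
  have "rb_mul lam (h p) (rb_prod lam (map h (q # u)))
      \<in> rb_on {w. deg_gens UNIV w
          = n * deg_gens {None} (p # q # u) + deg_gens (range Some) (p # q # u)}"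
    using 3(3)[of p] 3(2)[OF 3(3)]
    by (rule rb_on_mul)
      (auto intro!: rb_on_mono[OF prime_mul_word_mul_degrees(2)] simp: algebra_simps)
  then show ?case by simp
qed auto

lemma letter_subst_degree:
  assumes "s \<in> rb_on {w. deg_gens UNIV w = n}"
  shows "letter_subst lam s p
    \<in> rb_on {w. deg_gens UNIV w = n * letter_gens {None} p + letter_gens (range Some) p}"
proof (induction p)
  case (Gen y)
  then show ?case using assms by (cases y) (auto simp: rb_gen_def)
next
  case (Pw u)
  have "rb_prod lam (map (letter_subst lam s) u)
      \<in> rb_on {w. deg_gens UNIV w = n * deg_gens {None} u + deg_gens (range Some) u}"
    by (rule rb_prod_degree) (rule Pw)
  then show ?case
    by (simp, elim rb_on_P) simp
qed

lemma subst_degree: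
  assumes "s \<in> rb_on {w. deg_gens UNIV w = n}"
  shows "subst lam u s
    \<in> rb_on {w. deg_gens UNIV w = n * deg_gens {None} u + deg_gens (range Some) u}"
  unfolding subst_def by (rule rb_prod_degree[OF letter_subst_degree[OF assms]])

text \<open>A factor containing \<open>\<star>\<close> gives only words with a \<open>P\<close>,
  from \<open>s\<close> or from an enclosing \<open>P\<close>, and multiplication cannot remove the
  last \<open>P\<close>. Nothing is known about the other factors, hence the bound
  \<open>UNIV\<close> for them.\<close>

lemma subst_has_P:
  fixes s :: "('a, 'k::field) rb"
  assumes s: "s \<in> rb_on {w. 0 < deg_P w}" and u: "deg_gens {None} u \<noteq> 0"
  shows "subst lam u s \<in> rb_on {w. 0 < deg_P w}"
proof -
  have letter: "letter_subst lam s p \<in> rb_on {w. 0 < deg_P w}" if "letter_gens {None} p \<noteq> 0" for p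
    using that s by (cases p) (auto intro!: rb_on_P[of _ UNIV] simp: rb_on_def[of UNIV]
        split: option.splits if_splits)
  have UN: "f \<in> rb_on UNIV" for f :: "('a, 'k) rb"
    by (simp add: rb_on_def)
  show ?thesis
    using u unfolding subst_def
  proof (induction u rule: induct_list012)
    case (3 p q u)
    let ?f = "letter_subst lam s p" and ?g = "rb_prod lam (map (letter_subst lam s) (q # u))"
    have P: "word_mul lam u v \<in> rb_on {w. 0 < deg_P w}"
      if "0 < deg_P u \<or> 0 < deg_P v" for u v :: "'a word"
      by (rule rb_on_mono[OF prime_mul_word_mul_degrees(2)]) (use that in auto)
    have "?f \<in> rb_on {w. 0 < deg_P w} \<or> ?g \<in> rb_on {w. 0 < deg_P w}"
      using 3 letter by auto
    then have "rb_mul lam ?f ?g \<in> rb_on {w. 0 < deg_P w}"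
      using rb_on_mul[OF _ UN, where f = ?f and A = "{w. 0 < deg_P w}"]
        rb_on_mul[OF UN, where g = ?g and B = "{w. 0 < deg_P w}"] P
      by (metis (lifting) mem_Collect_eq)
    then show ?case by simp
  qed (auto simp: letter)
qed

section \<open>Triviality\<close>

lemma trivial_mod_zero: "trivial_mod lam S w 0"
  unfolding trivial_mod_def by (intro exI[of _ "[]"]) simp

lemma trivial_mod_add:
  assumes "trivial_mod lam S w f" "trivial_mod lam S w g"
  shows "trivial_mod lam S w (f + g)"
proof -
  obtain ts ts' where "f = (\<Sum>(\<alpha>, u, s)\<leftarrow>ts. rb_scale \<alpha> (subst lam u s))"
    "g = (\<Sum>(\<alpha>, u, s)\<leftarrow>ts'. rb_scale \<alpha> (subst lam u s))"
    "\<forall>(\<alpha>, u, s)\<in>set ts \<union> set ts'. s \<in> S \<and> u \<in> Phi_star \<and> normal lam u s \<and>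
       (\<exists>v. rb_word v = subst lam u (rb_word (lead s)) \<and> word_less v w)"
    using assms unfolding trivial_mod_def by blast
  then show ?thesis
    unfolding trivial_mod_def by (intro exI[of _ "ts @ ts'"]) simp
qed

lemma trivial_mod_scale:
  assumes "trivial_mod lam S w f"
  shows "trivial_mod lam S w (rb_scale c f)"
proof -
  obtain ts where ts: "f = (\<Sum>(\<alpha>, u, s)\<leftarrow>ts. rb_scale \<alpha> (subst lam u s))"
    "\<forall>(\<alpha>, u, s)\<in>set ts. s \<in> S \<and> u \<in> Phi_star \<and> normal lam u s \<and>
       (\<exists>v. rb_word v = subst lam u (rb_word (lead s)) \<and> word_less v w)"
    using assms unfolding trivial_mod_def by blast
  have "rb_scale c (\<Sum>(\<alpha>, u, s)\<leftarrow>ts. rb_scale \<alpha> (subst lam u s))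
      = (\<Sum>(\<alpha>, u, s)\<leftarrow>map (\<lambda>(\<alpha>, u, s). (c * \<alpha>, u, s)) ts. rb_scale \<alpha> (subst lam u s))" for ts
    by (induction ts) (auto simp: rb.scale_right_distrib)
  with ts show ?thesis
    unfolding trivial_mod_def
    by (intro exI[of _ "map (\<lambda>(\<alpha>, u, s). (c * \<alpha>, u, s)) ts"]) (auto split: prod.splits)
qed

lemma trivial_mod_diff:
  "trivial_mod lam S w f \<Longrightarrow> trivial_mod lam S w g \<Longrightarrow> trivial_mod lam S w (f - g)"
  using trivial_mod_add[of lam S w f "rb_scale (-1) g"] trivial_mod_scale[of lam S w g "-1"] by simp

text \<open>In a context of generators substitution is concatenation, so normality follows from
  \<open>top_word_conc\<close> and the comparison with \<open>w\<close> reduces to total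
  degrees.\<close>

lemma trivial_mod_context:
  assumes "s \<in> S" "s \<in> RB" "top_word s t" "length ys + deg_PX t + length zs < deg_PX w"
  shows "trivial_mod lam S w (rb_word (map Gen ys) \<odot> s \<odot> rb_word (map Gen zs))"
proof -
  let ?u = "embed (map Gen ys) @ star @ embed (map Gen zs)"
  let ?f = "rb_word (map Gen ys) \<odot> s \<odot> rb_word (map Gen zs)"
  have s: "s \<in> rb_on {u. u \<noteq> []}" and t: "t \<noteq> []"
    using assms(2,3) by (auto simp: RB_def rb_on_def top_word_def)
  have subst: "subst lam ?u s = ?f"
    "subst lam ?u (rb_word (lead s)) = rb_word (map Gen ys @ t @ map Gen zs)"
    using t by (simp_all add: subst_context s lead_eq_top_word[OF assms(3)])
  have top: "top_word ?f (map Gen ys @ t @ map Gen zs)"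
    by (rule top_word_conc[OF assms(3)])
  then have "?f \<noteq> 0"
    by (auto simp: top_word_def)
  then have "normal lam ?u s"
    by (simp only: normal_def subst lead_eq_top_word[OF top]) simp
  moreover have "word_less (map Gen ys @ t @ map Gen zs) w"
    using assms(4) by (intro word_less_of_deg_PX) simp
  ultimately show ?thesis
    unfolding trivial_mod_def using subst assms(1) context_in_Phi_star[of ys zs]
    by (intro exI[of _ "[(1, ?u, s)]"]) auto
qed


section \<open>The relations over an arbitrary dendriform dialgebra with a basis\<close>

locale dendriform_basis = dendriform_dialgebra scale prec succ
  for scale :: "'k::field \<Rightarrow> 'd::ab_group_add \<Rightarrow> 'd"
    and prec :: "'d \<Rightarrow> 'd \<Rightarrow> 'd" (infixl \<open>\<prec>\<close> 70)
    and succ :: "'d \<Rightarrow> 'd \<Rightarrow> 'd" (infixl \<open>\<succ>\<close> 70) +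
  fixes lam :: 'k and x :: "'i::linorder \<Rightarrow> 'd"
  assumes lam_nonzero: "lam \<noteq> 0"
    and inj_x: "inj x"
    and independent_x: "independent (range x)"
    and span_x: "span (range x) = UNIV"
begin

abbreviation \<iota> :: "'d \<Rightarrow> ('i, 'k) rb" where
  "\<iota> \<equiv> of_dend scale x"

abbreviation S :: "('i, 'k) rb set" where
  "S \<equiv> dend_relations lam scale prec succ x"

section \<open>Coordinates of dialgebra elements as elements of the free algebra\<close>

lemma finite_coordinates: "finite {n. representation (range x) d (x n) \<noteq> 0}"
  using finite_vimageI[OF finite_representation inj_x] by (simp add: vimage_def)

lemma of_dend_superset:
  assumes "finite N" "{n. representation (range x) d (x n) \<noteq> 0} \<subseteq> N"
  shows "\<iota> d = (\<Sum>n\<in>N. rb_scale (representation (range x) d (x n)) (rb_gen n))"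
  unfolding of_dend_def
  by (rule sum.mono_neutral_left) (use assms in auto)

lemma of_dend_hom: "module_hom scale rb_scale \<iota>"
proof (unfold_locales, goal_cases)
  case (1 a b)
  let ?N = "{n. representation (range x) a (x n) \<noteq> 0} \<union> {n. representation (range x) b (x n) \<noteq> 0}"
  have "representation (range x) (a + b) =
      (\<lambda>v. representation (range x) a v + representation (range x) b v)"
    by (rule representation_add[OF independent_x]) (simp_all add: span_x)
  then show ?case
    by (subst (1 2 3) of_dend_superset[of ?N])
      (auto simp: finite_coordinates rb.scale_left_distrib sum.distrib)
next
  case (2 c a)
  have "representation (range x) (scale c a) = (\<lambda>v. c * representation (range x) a v)"
    by (rule representation_scale[OF independent_x]) (simp add: span_x)
  then show ?case
    by (subst (1 2) of_dend_superset[of "{n. representation (range x) a (x n) \<noteq> 0}"])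
      (auto simp: finite_coordinates rb.scale_sum_right)
qed

lemma of_dend_basis [simp]: "\<iota> (x n) = rb_word [Gen n]"
proof -
  have "representation (range x) (x n) = (\<lambda>v. if v = x n then 1 else 0)"
    by (rule representation_basis[OF independent_x]) simp
  then have "\<iota> (x n) = rb_gen n"
    by (subst of_dend_superset[of "{n}"]) (auto dest: injD[OF inj_x] split: if_splits)
  then show ?thesis by (simp add: rb_gen_def)
qed

lemma rb_on_of_dend: "(\<And>n. [Gen n] \<in> A) \<Longrightarrow> \<iota> d \<in> rb_on A"
  unfolding of_dend_def rb_gen_def by (intro rb_on_sum rb_on_scale) simp

lemmas dend_hom_simps = hom_simps
  module_hom.add[OF of_dend_hom] module_hom.diff[OF of_dend_hom] module_hom.scale[OF of_dend_hom]
  module_hom.add[OF prec_linear_left] module_hom.add[OF prec_linear_right]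
  module_hom.add[OF succ_linear_left] module_hom.add[OF succ_linear_right]
  module_hom.scale[OF prec_linear_left] module_hom.scale[OF prec_linear_right]
  module_hom.scale[OF succ_linear_left] module_hom.scale[OF succ_linear_right]

section \<open>The relations with arbitrary arguments\<close>

definition rel1 :: "'d \<Rightarrow> 'd \<Rightarrow> ('i, 'k) rb" where
  "rel1 a b = \<iota> a \<odot> rb_P (\<iota> b) + rb_scale lam (\<iota> a \<odot> \<iota> b) - \<iota> (a \<prec> b)"

definition rel2 :: "'d \<Rightarrow> 'd \<Rightarrow> ('i, 'k) rb" where
  "rel2 a b = rb_P (\<iota> a) \<odot> \<iota> b - \<iota> (a \<succ> b)"

definition rel3 :: "'d \<Rightarrow> 'd \<Rightarrow> 'd \<Rightarrow> ('i, 'k) rb" where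
  "rel3 a b c = \<iota> a \<odot> \<iota> b \<odot> \<iota> c - rb_scale (inverse lam) (\<iota> (a \<prec> b) \<odot> \<iota> c)
     + rb_scale (inverse lam) (\<iota> a \<odot> \<iota> (b \<succ> c))"

lemmas rel_defs = rel1_def rel2_def rel3_def

text \<open>Every product in the defining relations has a generator on one side of the junction, so
  \<open>rb_mul\<close> turns into concatenation.\<close>

lemma dend_relations_eq:
  "S = {rel1 (x i) (x j) | i j. True} \<union> {rel2 (x i) (x j) | i j. True}
     \<union> {rel3 (x i) (x j) (x l) | i j l. True}"
proof -
  have *: "rb_mul lam (\<iota> d) (rb_word [Gen l]) = \<iota> d \<odot> rb_word [Gen l]"
    "rb_mul lam (rb_word [Gen l]) (\<iota> d) = rb_word [Gen l] \<odot> \<iota> d" for d l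
    by (rule rb_mul_eq_conc; simp add: rb_on_of_dend)+
  show ?thesis
    by (simp add: dend_relations_def Let_def rel_defs rb_gen_def rb_mul_eq_conc *)
qed

lemma rel_in_S: "rel1 (x i) (x j) \<in> S" "rel2 (x i) (x j) \<in> S" "rel3 (x i) (x j) (x l) \<in> S"
  unfolding dend_relations_eq by blast+

lemmas rel_in_RB = rel_in_S[THEN subsetD[OF dend_relations_subset_RB]]

lemma rel_words:
  "rel1 (x i) (x j) = rb_word [Gen i, Pw [Gen j]] + rb_scale lam (rb_word [Gen i, Gen j]) - \<iota> (x i \<prec> x j)"
  "rel2 (x i) (x j) = rb_word [Pw [Gen i], Gen j] - \<iota> (x i \<succ> x j)"
  "rel3 (x i) (x j) (x l) = rb_word [Gen i, Gen j, Gen l]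
    - rb_scale (inverse lam) (\<iota> (x i \<prec> x j) \<odot> rb_word [Gen l])
    + rb_scale (inverse lam) (rb_word [Gen i] \<odot> \<iota> (x j \<succ> x l))"
  by (simp_all add: rel_defs)

text \<open>Since \<open>P\<close> counts towards \<open>deg_PX\<close>, each leading word has total
  degree 3, while all remaining terms have degree 1 or 2.\<close>

lemma top_rel:
  "top_word (rel1 (x i) (x j)) [Gen i, Pw [Gen j]]"
  "top_word (rel2 (x i) (x j)) [Pw [Gen i], Gen j]"
  "top_word (rel3 (x i) (x j) (x l)) [Gen i, Gen j, Gen l]"
proof -
  have "rb_scale lam (rb_word [Gen i, Gen j]) - \<iota> (x i \<prec> x j)
      \<in> rb_on {v. deg_PX v < deg_PX [Gen i, Pw [Gen j]]}"
    by (intro rb_on_diff rb_on_scale rb_on_of_dend) (simp_all add: deg_PX_def)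
  from top_wordI[OF this] show "top_word (rel1 (x i) (x j)) [Gen i, Pw [Gen j]]"
    by (simp add: rel_words algebra_simps)
  have "0 - \<iota> (x i \<succ> x j) \<in> rb_on {v. deg_PX v < deg_PX [Pw [Gen i], Gen j]}"
    by (intro rb_on_diff rb_on_of_dend) (simp_all add: deg_PX_def)
  from top_wordI[OF this] show "top_word (rel2 (x i) (x j)) [Pw [Gen i], Gen j]"
    by (simp add: rel_words)
  have "rb_scale (inverse lam) (rb_word [Gen i] \<odot> \<iota> (x j \<succ> x l))
        - rb_scale (inverse lam) (\<iota> (x i \<prec> x j) \<odot> rb_word [Gen l])
      \<in> rb_on {v. deg_PX v < deg_PX [Gen i, Gen j, Gen l]}"
    by (intro rb_on_diff rb_on_scale rb_on_conc[where A = "range (\<lambda>n. [Gen n])"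
          and B = "range (\<lambda>n. [Gen n])"]
        rb_on_of_dend) (auto simp: deg_PX_def)
  from top_wordI[OF this] show "top_word (rel3 (x i) (x j) (x l)) [Gen i, Gen j, Gen l]"
    by (simp add: rel_words algebra_simps)
qed

lemmas lead_rel = top_rel[THEN lead_eq_top_word]

lemma rel_nonempty: "s \<in> S \<Longrightarrow> s \<in> rb_on {u. u \<noteq> []}"
  using subsetD[OF dend_relations_subset_RB, of s lam scale prec succ x]
  by (auto simp: RB_def rb_on_def)

text \<open>\<open>rel2\<close> is absent here, and \<open>rel1\<close> from
  \<open>rel_ends\<close>, because their leading words begin, respectively end, with a
  \<open>P\<close>-factor. This explains the extra side conditions in \<open>rel_mul_word\<close>
  and \<open>word_mul_rel\<close>.\<close>

lemma rel_starts:
  "rel1 a b \<in> rb_on {u. hd u \<in> range Gen}" "rel3 a b c \<in> rb_on {u. hd u \<in> range Gen}"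
proof -
  let ?G = "{[Gen n] | n. True}"
  have i: "\<iota> d \<in> rb_on ?G" for d by (rule rb_on_of_dend) auto
  have c: "\<iota> d \<odot> f \<in> rb_on {u. hd u \<in> range Gen}" for d f
    by (rule rb_on_conc[OF i, where B = UNIV]) (auto simp: rb_on_def)
  show "rel1 a b \<in> rb_on {u. hd u \<in> range Gen}" "rel3 a b c \<in> rb_on {u. hd u \<in> range Gen}"
    unfolding rel_defs conc_assoc
    by (intro rb_on_add rb_on_diff rb_on_scale c rb_on_of_dend; simp)+
qed

lemma rel_ends:
  "rel2 a b \<in> rb_on {u. last u \<in> range Gen}" "rel3 a b c \<in> rb_on {u. last u \<in> range Gen}"
proof -
  let ?G = "{[Gen n] | n. True}"
  have i: "\<iota> d \<in> rb_on ?G" for d by (rule rb_on_of_dend) auto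
  have c: "f \<odot> \<iota> d \<in> rb_on {u. last u \<in> range Gen}" for d f
    by (rule rb_on_conc[OF _ i, where A = UNIV]) (auto simp: rb_on_def)
  show "rel2 a b \<in> rb_on {u. last u \<in> range Gen}" "rel3 a b c \<in> rb_on {u. last u \<in> range Gen}"
    unfolding rel_defs
    by (intro rb_on_add rb_on_diff rb_on_scale c rb_on_of_dend; simp)+
qed

lemma rel_mul_word:
  "u \<noteq> [] \<Longrightarrow> hd u \<in> range Gen \<Longrightarrow> rb_mul lam (rel1 (x i) (x j)) (rb_word u)
    = rel1 (x i) (x j) \<odot> rb_word u"
  "u \<noteq> [] \<Longrightarrow> rb_mul lam (rel2 (x i) (x j)) (rb_word u) = rel2 (x i) (x j) \<odot> rb_word u"
  "u \<noteq> [] \<Longrightarrow> rb_mul lam (rel3 (x i) (x j) (x l)) (rb_word u) = rel3 (x i) (x j) (x l) \<odot> rb_word u"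
  by (rule rb_mul_eq_conc; use rel_ends rel_in_S[THEN rel_nonempty] in simp)+

lemma word_mul_rel:
  "u \<noteq> [] \<Longrightarrow> rb_mul lam (rb_word u) (rel1 (x i) (x j)) = rb_word u \<odot> rel1 (x i) (x j)"
  "u \<noteq> [] \<Longrightarrow> last u \<in> range Gen \<Longrightarrow> rb_mul lam (rb_word u) (rel2 (x i) (x j))
    = rb_word u \<odot> rel2 (x i) (x j)"
  "u \<noteq> [] \<Longrightarrow> rb_mul lam (rb_word u) (rel3 (x i) (x j) (x l)) = rb_word u \<odot> rel3 (x i) (x j) (x l)"
  by (rule rb_mul_eq_conc; use rel_starts rel_in_S[THEN rel_nonempty] in simp)+


section \<open>Triviality of the relations in context\<close>

text \<open>Triviality is closed under linear combinations, so a linear argument may be replaced by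
  a basis vector; the rule is applied once per argument.\<close>

lemma trivial_mod_linear:
  assumes "module_hom scale rb_scale T" and "\<And>n. trivial_mod lam S w (T (x n))"
  shows "trivial_mod lam S w (T a)"
proof -
  interpret module_hom scale rb_scale T by fact
  have "a \<in> span (range x)" by (simp add: span_x)
  then show ?thesis
    by (induction rule: span_induct_alt)
      (auto simp: zero add scale trivial_mod_zero intro: trivial_mod_add trivial_mod_scale assms(2))
qed

text \<open>The summand 3 is the total degree of each leading word.\<close>

lemma rel_context:
  "length ys + length zs + 3 < deg_PX w \<Longrightarrow>
    trivial_mod lam S w (rb_word (map Gen ys) \<odot> rel1 (x i) (x j) \<odot> rb_word (map Gen zs))"
  "length ys + length zs + 3 < deg_PX w \<Longrightarrow>
    trivial_mod lam S w (rb_word (map Gen ys) \<odot> rel2 (x i) (x j) \<odot> rb_word (map Gen zs))"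
  "length ys + length zs + 3 < deg_PX w \<Longrightarrow>
    trivial_mod lam S w (rb_word (map Gen ys) \<odot> rel3 (x i) (x j) (x l) \<odot> rb_word (map Gen zs))"
  by (rule trivial_mod_context[OF rel_in_S(1) rel_in_RB(1) top_rel(1)]
      trivial_mod_context[OF rel_in_S(2) rel_in_RB(2) top_rel(2)]
      trivial_mod_context[OF rel_in_S(3) rel_in_RB(3) top_rel(3)];
      simp add: deg_PX_def)+

lemma rel_hom:
  "module_hom scale rb_scale (\<lambda>a. rel1 a b)" "module_hom scale rb_scale (\<lambda>b. rel1 a b)"
  "module_hom scale rb_scale (\<lambda>a. rel2 a b)" "module_hom scale rb_scale (\<lambda>b. rel2 a b)"
  "module_hom scale rb_scale (\<lambda>a. rel3 a b c)" "module_hom scale rb_scale (\<lambda>b. rel3 a b c)"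
  "module_hom scale rb_scale (\<lambda>c. rel3 a b c)"
  by (unfold_locales; simp add: rel_defs dend_hom_simps rb.scale_right_distrib rb.scale_right_diff_distrib
      algebra_simps)+

lemma trivial_rel:
  assumes "3 < deg_PX w"
  shows "trivial_mod lam S w (rel1 a b)" "trivial_mod lam S w (rel2 a b)"
    "trivial_mod lam S w (rel3 a b c)"
proof -
  note ctx = rel_context[of "[]" "[]" w, simplified, OF assms]
  note lin = rel_hom[THEN trivial_mod_linear]
  show "trivial_mod lam S w (rel1 a b)"
    by (rule lin(1), rule lin(2), rule ctx)
  show "trivial_mod lam S w (rel2 a b)"
    by (rule lin(3), rule lin(4), rule ctx)
  show "trivial_mod lam S w (rel3 a b c)"
    by (rule lin(5), rule lin(6), rule lin(7), rule ctx)
qed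

text \<open>These are the one-generator contexts that occur in
  \<open>composition_identities\<close>; 4 is the degree 3 of a leading word plus one
  generator.\<close>

lemma trivial_rel_context:
  assumes "4 < deg_PX w"
  shows "trivial_mod lam S w (\<iota> a \<odot> rel1 b c)" "trivial_mod lam S w (\<iota> a \<odot> rel3 b c d)"
    "trivial_mod lam S w (rel2 a b \<odot> \<iota> c)" "trivial_mod lam S w (rel3 a b c \<odot> \<iota> d)"
proof -
  note left = rel_context[of "[n]" "[]" w for n, simplified, OF assms]
  note right = rel_context[of "[]" "[n]" w for n, simplified, OF assms]
  \<comment> \<open>\<open>lin\<close> reduces the outer factor to a basis vector;
    \<open>linl\<close> and \<open>linr\<close> do so for the arguments of a relation that stands to
    the right, respectively left, of a fixed factor.\<close>
  note lin = of_dend_hom[THEN module_hom_compose, OF conc_hom_left, unfolded comp_def,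
      THEN trivial_mod_linear]
    of_dend_hom[THEN module_hom_compose, OF conc_hom_right, unfolded comp_def,
      THEN trivial_mod_linear]
  note linl = rel_hom[THEN module_hom_compose, OF conc_hom_right, unfolded comp_def,
      THEN trivial_mod_linear]
  note linr = rel_hom[THEN module_hom_compose, OF conc_hom_left, unfolded comp_def,
      THEN trivial_mod_linear]
  show "trivial_mod lam S w (\<iota> a \<odot> rel1 b c)"
    by (rule lin(1), rule linl(1), rule linl(2)) (simp add: left)
  show "trivial_mod lam S w (\<iota> a \<odot> rel3 b c d)"
    by (rule lin(1), rule linl(5), rule linl(6), rule linl(7)) (simp add: left)
  show "trivial_mod lam S w (rel2 a b \<odot> \<iota> c)"
    by (rule lin(2), rule linr(3), rule linr(4)) (simp add: right)
  show "trivial_mod lam S w (rel3 a b c \<odot> \<iota> d)"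
    by (rule lin(2), rule linr(5), rule linr(6), rule linr(7)) (simp add: right)
qed


section \<open>The critical identities\<close>


text \<open>The axiom \<open>succ_succ\<close> reversed and expanded: additivity rewriting breaks up
  the sum on its left side, so as a rewrite rule it has to start from the nested form.\<close>

lemma succ_succ': "a \<succ> (b \<succ> c) = (a \<prec> b) \<succ> c + (a \<succ> b) \<succ> c"
  by (simp add: dend_hom_simps flip: succ_succ)

text \<open>The top words cancel on each left side. The first identity uses no axiom and shows the
  origin of \<open>rel3\<close>: it is \<open>inverse lam\<close> times the composition of the first
  two kinds. The second, third, fourth and sixth rest on \<open>succ_prec\<close>, the fifth on
  \<open>prec_prec\<close> and \<open>succ_succ\<close>.\<close>

lemma composition_identities:
  "rel1 a b \<odot> \<iota> c - \<iota> a \<odot> rel2 b c = rb_scale lam (rel3 a b c)"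
  "rel2 a b \<odot> rb_P (\<iota> c) - rb_P (\<iota> a) \<odot> rel1 b c
    = rel2 a (b \<prec> c) - rel1 (a \<succ> b) c - rb_scale lam (rel2 a b \<odot> \<iota> c)"
  "rel2 a b \<odot> \<iota> c \<odot> \<iota> d - rb_P (\<iota> a) \<odot> rel3 b c d
    = rb_scale (inverse lam) (rel2 a (b \<prec> c) \<odot> \<iota> d) - rb_scale (inverse lam) (rel2 a b \<odot> \<iota> (c \<succ> d))
      - rel3 (a \<succ> b) c d"
  "rel3 a b c \<odot> rb_P (\<iota> d) - \<iota> a \<odot> \<iota> b \<odot> rel1 c d
    = rb_scale (inverse lam) (\<iota> a \<odot> rel1 (b \<succ> c) d) - rb_scale (inverse lam) (\<iota> (a \<prec> b) \<odot> rel1 c d)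
      - rb_scale lam (rel3 a b c \<odot> \<iota> d) + rel3 a b (c \<prec> d)"
  "rel3 a b c \<odot> \<iota> d - \<iota> a \<odot> rel3 b c d
    = rb_scale (inverse lam) (rel3 a (b \<prec> c + b \<succ> c) d - rel3 (a \<prec> b) c d - rel3 a b (c \<succ> d))"
  "rel3 a b c \<odot> \<iota> d \<odot> \<iota> e - \<iota> a \<odot> \<iota> b \<odot> rel3 c d e
    = rb_scale (inverse lam) (\<iota> a \<odot> rel3 (b \<succ> c) d e - \<iota> (a \<prec> b) \<odot> rel3 c d e
        + rel3 a b (c \<prec> d) \<odot> \<iota> e - rel3 a b c \<odot> \<iota> (d \<succ> e))"
  by (simp_all add: rel_defs dend_hom_simps prec_prec succ_prec succ_succ' conc_assoc lam_nonzero
      algebra_simps rb.scale_right_distrib rb.scale_right_diff_distrib)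

section \<open>Intersection compositions\<close>

lemma S_cases:
  assumes "f \<in> S"
  obtains i j where "f = rel1 (x i) (x j)" | i j where "f = rel2 (x i) (x j)"
  | i j l where "f = rel3 (x i) (x j) (x l)"
  using assms unfolding dend_relations_eq by blast

lemma intersection_trivial:
  assumes f: "f \<in> S" and g: "g \<in> S" and comp: "intersection_composition lam f g w h"
  shows "trivial_mod lam S w h"
proof -
  from comp obtain a b where a: "a \<in> Phi" and b: "b \<in> Phi" and w: "w = lead f @ a" "w = b @ lead g"
    and deg: "deg_PX w < deg_PX (lead f) + deg_PX (lead g)"
    and h: "h = rb_mul lam f (rb_word a) - rb_mul lam (rb_word b) g"
    unfolding intersection_composition_def by blast
  have ne: "a \<noteq> []" "b \<noteq> []" using a b by auto
  obtain c where c: "lead f = b @ c" "lead g = c @ a" "c \<noteq> []"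
    using w deg by (metis overlap)
  \<comment> \<open>Five of the nine pairs of kinds have a last letter of \<open>lead f\<close>
    matching a first letter of \<open>lead g\<close>. Two relations of the third kind can overlap in
    two letters or in one, which gives six cases.\<close>
  consider
    (pair12) i j k where "f = rel1 (x i) (x j)" "g = rel2 (x j) (x k)" "b = [Gen i]" "a = [Gen k]"
  | (pair21) i j k where "f = rel2 (x i) (x j)" "g = rel1 (x j) (x k)"
      "b = [Pw [Gen i]]" "a = [Pw [Gen k]]"
  | (pair23) i j k l where "f = rel2 (x i) (x j)" "g = rel3 (x j) (x k) (x l)"
      "b = [Pw [Gen i]]" "a = [Gen k, Gen l]"
  | (pair31) i j k l where "f = rel3 (x i) (x j) (x k)" "g = rel1 (x k) (x l)"
      "b = [Gen i, Gen j]" "a = [Pw [Gen l]]"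
  | (pair33_two) i j k l where "f = rel3 (x i) (x j) (x k)" "g = rel3 (x j) (x k) (x l)"
      "b = [Gen i]" "a = [Gen l]"
  | (pair33_one) i j k l m where "f = rel3 (x i) (x j) (x k)" "g = rel3 (x k) (x l) (x m)"
      "b = [Gen i, Gen j]" "a = [Gen l, Gen m]"
    by (rule S_cases[OF f]; rule S_cases[OF g];
        use c ne in \<open>auto simp: lead_rel Cons_eq_append_conv\<close>)
  then show ?thesis
  proof cases
    case pair12
    have "h = rb_scale lam (rel3 (x i) (x j) (x k))"
      using composition_identities(1)[of "x i" "x j" "x k"]
      by (simp add: h pair12 rel_mul_word word_mul_rel)
    \<comment> \<open>Here and in \<open>pair33_two\<close> the word \<open>w\<close> has degree 4,
      which leaves room for bare relations only; in the other cases it has degree 5.\<close>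
    moreover have "3 < deg_PX w" by (simp add: w(1) pair12 lead_rel deg_PX_def)
    ultimately show ?thesis by (simp add: trivial_mod_scale trivial_rel)
  next
    case pair21
    have "h = rel2 (x i) (x j \<prec> x k) - rel1 (x i \<succ> x j) (x k)
        - rb_scale lam (rel2 (x i) (x j) \<odot> \<iota> (x k))"
      using composition_identities(2)[of "x i" "x j" "x k"]
      by (simp add: h pair21 rel_mul_word word_mul_rel)
    moreover have "4 < deg_PX w" by (simp add: w(1) pair21 lead_rel deg_PX_def)
    ultimately show ?thesis
      \<comment> \<open>The terms \<open>\<iota> (x k)\<close> must stay folded to match
        \<open>trivial_rel_context\<close>.\<close>
      by (auto intro!: trivial_mod_diff trivial_mod_scale trivial_rel trivial_rel_context
        simp del: of_dend_basis)
  next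
    case pair23
    have "h = rb_scale (inverse lam) (rel2 (x i) (x j \<prec> x k) \<odot> \<iota> (x l))
        - rb_scale (inverse lam) (rel2 (x i) (x j) \<odot> \<iota> (x k \<succ> x l)) - rel3 (x i \<succ> x j) (x k) (x l)"
      using composition_identities(3)[of "x i" "x j" "x k" "x l"]
      by (simp add: h pair23 rel_mul_word word_mul_rel conc_assoc)
    moreover have "4 < deg_PX w" by (simp add: w(1) pair23 lead_rel deg_PX_def)
    ultimately show ?thesis
      by (auto intro!: trivial_mod_diff trivial_mod_scale trivial_rel trivial_rel_context
        simp del: of_dend_basis)
  next
    case pair31
    have "h = rb_scale (inverse lam) (\<iota> (x i) \<odot> rel1 (x j \<succ> x k) (x l))
        - rb_scale (inverse lam) (\<iota> (x i \<prec> x j) \<odot> rel1 (x k) (x l))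
        - rb_scale lam (rel3 (x i) (x j) (x k) \<odot> \<iota> (x l)) + rel3 (x i) (x j) (x k \<prec> x l)"
      using composition_identities(4)[of "x i" "x j" "x k" "x l"]
      by (simp add: h pair31 rel_mul_word word_mul_rel)
    moreover have "4 < deg_PX w" by (simp add: w(1) pair31 lead_rel deg_PX_def)
    ultimately show ?thesis
      by (auto intro!: trivial_mod_add trivial_mod_diff trivial_mod_scale trivial_rel trivial_rel_context
        simp del: of_dend_basis)
  next
    case pair33_two
    have "h = rb_scale (inverse lam) (rel3 (x i) (x j \<prec> x k + x j \<succ> x k) (x l)
        - rel3 (x i \<prec> x j) (x k) (x l) - rel3 (x i) (x j) (x k \<succ> x l))"
      using composition_identities(5)[of "x i" "x j" "x k" "x l"]
      by (simp add: h pair33_two rel_mul_word word_mul_rel)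
    moreover have "3 < deg_PX w" by (simp add: w(1) pair33_two lead_rel deg_PX_def)
    ultimately show ?thesis
      by (auto intro!: trivial_mod_diff trivial_mod_scale trivial_rel)
  next
    case pair33_one
    have "h = rb_scale (inverse lam) (\<iota> (x i) \<odot> rel3 (x j \<succ> x k) (x l) (x m)
        - \<iota> (x i \<prec> x j) \<odot> rel3 (x k) (x l) (x m)
        + rel3 (x i) (x j) (x k \<prec> x l) \<odot> \<iota> (x m) - rel3 (x i) (x j) (x k) \<odot> \<iota> (x l \<succ> x m))"
      using composition_identities(6)[of "x i" "x j" "x k" "x l" "x m"]
      by (simp add: h pair33_one rel_mul_word word_mul_rel conc_assoc)
    moreover have "4 < deg_PX w" by (simp add: w(1) pair33_one lead_rel deg_PX_def)
    ultimately show ?thesis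
      by (auto intro!: trivial_mod_add trivial_mod_diff trivial_mod_scale trivial_rel_context
        simp del: of_dend_basis)
  qed
qed

section \<open>Inclusion compositions\<close>

lemma lead_inj: "f \<in> S \<Longrightarrow> g \<in> S \<Longrightarrow> lead f = lead g \<Longrightarrow> f = g"
  by (erule S_cases; erule S_cases; simp add: lead_rel)

lemma inclusion_trivial:
  assumes f: "f \<in> S" and g: "g \<in> S" and comp: "inclusion_composition lam f g w h"
  shows "trivial_mod lam S w h"
proof -
  from comp obtain u where u: "u \<in> Phi" "deg_gens {None} u = 1" and w: "w = lead f"
    and subst: "rb_word w = subst lam u (rb_word (lead g) :: ('i, 'k) rb)"
    and h: "h = f - subst lam u g"
    unfolding inclusion_composition_def Phi_star_def by blast
  have "u = star"
  proof (cases "\<exists>p. u = [p]")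
    case True
    then obtain p where p: "u = [p]" by blast
    show ?thesis
    proof (cases p)
      case (Gen y)
      then show ?thesis using u(2) p by (cases y) (auto simp: star_def)
    next
      \<comment> \<open>A context \<open>P(v)\<close> produces only words with a single prime
        factor, but leading words in \<open>S\<close> have two or three.\<close>
      case (Pw v)
      have "subst lam u (rb_word (lead g) :: ('i, 'k) rb) \<in> rb_on {v. length v = 1}"
        unfolding p Pw subst_def by (auto intro!: rb_on_P[of _ UNIV] simp: rb_on_def[of UNIV])
      then have "length (lead f) = 1"
        by (simp add: w flip: subst)
      then show ?thesis using f by (auto elim!: S_cases simp: lead_rel)
    qed
  next
    case False
    \<comment> \<open>\<open>remdups_adj.cases\<close> merely splits lists into length 0, 1 and at
      least 2. With two or more primes, \<open>u\<close> contains a generator other than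
      \<open>\<star>\<close>, so \<open>lead g\<close> has fewer generators than
      \<open>lead f\<close>.\<close>
    then have "1 < length u"
      using u(1) by (cases u rule: remdups_adj.cases) auto
    moreover have "deg_gens UNIV u = deg_gens {None} u + deg_gens (range Some) u"
      using deg_gens_disjoint_union[of "{None}" "range Some" u] by (simp add: UNIV_option_conv)
    ultimately have pos: "0 < deg_gens (range Some) u"
      using length_le_deg_gens[OF u(1)] u(2) by simp
    have "(rb_word w :: ('i, 'k) rb) \<in> rb_on {w. deg_gens UNIV w
        = deg_gens UNIV (lead g) * deg_gens {None} u + deg_gens (range Some) u}"
      unfolding subst by (rule subst_degree) auto
    then have "deg_gens UNIV (lead g) < deg_gens UNIV (lead f)"
      using u(2) pos w by simp
    \<comment> \<open>Leading words have two generators for the first two kinds and three for the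
      third, so \<open>f\<close> is of the third kind and \<open>g\<close> is not.\<close>
    then have "deg_P (lead f) = 0" "0 < deg_P (lead g)"
      using f g by (auto elim!: S_cases simp: lead_rel)
    then have "(rb_word w :: ('i, 'k) rb) \<in> rb_on {w. 0 < deg_P w}"
      unfolding subst using u(2) by (intro subst_has_P) auto
    with \<open>deg_P (lead f) = 0\<close> w show ?thesis by simp
  qed
  \<comment> \<open>The leading word determines the kind and the indices of a relation, so
    \<open>f = g\<close> and the composition is 0.\<close>
  then have "lead f = lead g" "h = f - g"
    using subst w h by (simp_all add: subst_def star_def)
  with lead_inj[OF f g] show ?thesis
    by (simp add: trivial_mod_zero)
qed

end

theorem theorem4p4:
  fixes lam :: "'k::field_char_0"
    and scale :: "'k \<Rightarrow> 'd::ab_group_add \<Rightarrow> 'd"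
    and prec succ :: "'d \<Rightarrow> 'd \<Rightarrow> 'd"
    and x :: "'i::wellorder \<Rightarrow> 'd"
  assumes "lam \<noteq> 0"
    and "dendriform_dialgebra scale prec succ"
    and "inj x"
    and "\<not> module.dependent scale (range x)"
    and "module.span scale (range x) = UNIV"
  shows "\<forall>f\<in>dend_relations lam scale prec succ x. \<forall>g\<in>dend_relations lam scale prec succ x. \<forall>w h.
    intersection_composition lam f g w h \<or> inclusion_composition lam f g w h \<longrightarrow>
    trivial_mod lam (dend_relations lam scale prec succ x) w h"
proof -
  interpret dendriform_dialgebra scale prec succ by fact
  interpret dendriform_basis scale prec succ lam x
    by unfold_locales fact+
  show ?thesis
    using intersection_trivial inclusion_trivial by blast
qed

end
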